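(* Let $\Delta$ be a simplicial complex on $[n]$. Suppose that $\mathbf r\cdot\mathbf z\le r_0$ is a facet-defining inequality for $\mathrm{Marg}(\Delta)$ and $\mathbf r$ lies in the row space of $\Omega_\Delta$. Fix $I\subset[n]$ and define the linear functional $$\mathbf r^{\langle I\rangle}:=(\mathbf r\,\Pi_\Delta\Psi_\Delta)^{(I)}\,\Phi_\Delta\Omega_\Delta$$ and the scalar $r_0^{\langle I\rangle}:=r_0-(\mathbf r\,\Pi_\Delta\Psi_\Delta)\cdot\mathbf d^I$. Then $\mathbf r^{\langle I\rangle}\cdot\mathbf z\le r_0^{\langle I\rangle}$ is a facet-defining inequality for $\mathrm{Marg}(\Delta)$.
   Context: For a simplicial complex $\Delta$ on $[n]$ (a nonempty family of subsets of $[n]$ closed under taking subsets), $\overline\Delta=\Delta\setminus\{\emptyset\}$, $\mathrm{facets}(\Delta)$ is the set of inclusion-maximal faces, and $\mathcal E(\Delta)=\{(H,F) : H\subset F\in\mathrm{facets}(\Delta)\}$. Linear functionals are row vectors; $A_i^j$ denotes the entry of a matrix $A$ in row $i$ and column $j$. Binary marginal polytope: $\mathrm{Marg}(\Delta)=\mathrm{conv}\{\mathbf u^S : S\subset[n]\}\subset\mathbb R^{\mathcal E(\Delta)}$, where $u^S_{(H,F)}=1$ if $S\cap F=H$ and $0$ otherwise. (It is usually not full-dimensional; an inequality is facet-defining if it is valid on the polytope and equality cuts out a facet.) For $S\subset[n]$, $\mathbf d^S\in\mathbb R^{\overline\Delta}$ has $d^S_F=1$ if $\#(F\cap S)$ is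 odd and $0$ if even. Matrices: - $\Phi_\Delta\in\mathbb R^{\overline\Delta\times\overline\Delta}$, $(\Phi_\Delta)_F^H=(-2)^{\#H-1}$ if $H\subset F$, else $0$. - $\Psi_\Delta=\Phi_\Delta^{-1}$, given by $(\Psi_\Delta)_H^G=(-1)^{\#G-1}/2^{\#H-1}$ if $G\subset H$, else $0$. - $\Omega_\Delta\in\mathbb R^{\overline\Delta\times\mathcal E(\Delta)}$, $(\Omega_\Delta)_T^{(H,F)}=1/f(T)$ if $T\subset H$, else $0$, where $f(T)$ is the number of facets of $\Delta$ containing $T$. - $\Pi_\Delta\in\mathbb R^{\mathcal E(\Delta)\times\overline\Delta}$, $(\Pi_\Delta)_{(H,F)}^T=(-1)^{\#H+\#T}$ if $H\subset T\subset F$, else $0$. For a row vector $\mathbf a$ indexed by $\overline\Delta$ and $I\subset[n]$, $\mathbf a^{(I)}$ is defined by $a^{(I)}_F=(-1)^{\#(I\cap F)}a_F$. *)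

theory Defs
  imports "HOL-Analysis.Analysis"
begin

text \<open>
  The ground set \<open>[n]\<close> is rendered as an arbitrary set \<open>V\<close> of elements of a finite type \<open>'v\<close>
  (so every \<open>n\<close>, including \<open>n = 0\<close>, occurs as \<open>card V\<close>).

  A vector space \<open>\<real>\<^sup>I\<close> with \<open>I\<close> the set of nonempty faces, respectively the set of pairs
  \<open>(H, F)\<close> with \<open>H \<subseteq> F\<close> and \<open>F\<close> a facet, is rendered as the coordinate subspace of
  \<open>real ^ 'v set\<close>, respectively \<open>real ^ ('v set \<times> 'v set)\<close>, of vectors vanishing outside \<open>I\<close>.
  Accordingly all vectors and matrices below are padded with zeros outside their index sets, so
  that products and inner products are sums over the actual index sets.
\<close>

definition abstract_simplicial_complex :: "'v set \<Rightarrow> 'v set set \<Rightarrow> bool" where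
  "abstract_simplicial_complex V \<Delta> \<longleftrightarrow>
     \<Delta> \<noteq> {} \<and> \<Delta> \<subseteq> Pow V \<and> (\<forall>F\<in>\<Delta>. \<forall>G. G \<subseteq> F \<longrightarrow> G \<in> \<Delta>)"

definition nonempty_faces :: "'v set set \<Rightarrow> 'v set set" where
  "nonempty_faces \<Delta> = \<Delta> - {{}}"

definition facets :: "'v set set \<Rightarrow> 'v set set" where
  "facets \<Delta> = {F \<in> \<Delta>. \<forall>G\<in>\<Delta>. F \<subseteq> G \<longrightarrow> G = F}"

definition facet_pairs :: "'v set set \<Rightarrow> ('v set \<times> 'v set) set" where
  "facet_pairs \<Delta> = {(H, F). H \<subseteq> F \<and> F \<in> facets \<Delta>}"

definition num_facets_containing :: "'v set set \<Rightarrow> 'v set \<Rightarrow> nat" where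
  "num_facets_containing \<Delta> T = card {F \<in> facets \<Delta>. T \<subseteq> F}"

definition marg_vertex :: "'v::finite set set \<Rightarrow> 'v set \<Rightarrow> real ^ ('v set \<times> 'v set)" where
  "marg_vertex \<Delta> S = (\<chi> p. if p \<in> facet_pairs \<Delta> \<and> S \<inter> snd p = fst p then 1 else 0)"

definition Marg :: "'v::finite set \<Rightarrow> 'v set set \<Rightarrow> (real ^ ('v set \<times> 'v set)) set" where
  "Marg V \<Delta> = convex hull {marg_vertex \<Delta> S |S. S \<subseteq> V}"

definition facet_defining :: "'a::euclidean_space set \<Rightarrow> 'a \<Rightarrow> real \<Rightarrow> bool" where
  "facet_defining P r r0 \<longleftrightarrow> (\<forall>z\<in>P. r \<bullet> z \<le> r0) \<and> {z \<in> P. r \<bullet> z = r0} facet_of P"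

definition parity_vec :: "'v::finite set set \<Rightarrow> 'v set \<Rightarrow> real ^ 'v set" where
  "parity_vec \<Delta> S = (\<chi> F. if F \<in> nonempty_faces \<Delta> \<and> odd (card (F \<inter> S)) then 1 else 0)"

text \<open>
  In \<open>real ^ 'c ^ 'r\<close> the rows are indexed by \<open>'r\<close> and the columns by \<open>'c\<close>; \<open>A $ i $ j\<close> is the
  entry in row \<open>i\<close> and column \<open>j\<close>.
\<close>

definition Phi_mat :: "'v::finite set set \<Rightarrow> real ^ 'v set ^ 'v set" where
  "Phi_mat \<Delta> = (\<chi> F H. if F \<in> nonempty_faces \<Delta> \<and> H \<in> nonempty_faces \<Delta> \<and> H \<subseteq> F
     then (- 2) ^ (card H - 1) else 0)"

definition Psi_mat :: "'v::finite set set \<Rightarrow> real ^ 'v set ^ 'v set" where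
  "Psi_mat \<Delta> = (\<chi> H G. if H \<in> nonempty_faces \<Delta> \<and> G \<in> nonempty_faces \<Delta> \<and> G \<subseteq> H
     then (- 1) ^ (card G - 1) / 2 ^ (card H - 1) else 0)"

definition Omega_mat :: "'v::finite set set \<Rightarrow> real ^ ('v set \<times> 'v set) ^ 'v set" where
  "Omega_mat \<Delta> = (\<chi> T p. if T \<in> nonempty_faces \<Delta> \<and> p \<in> facet_pairs \<Delta> \<and> T \<subseteq> fst p
     then 1 / real (num_facets_containing \<Delta> T) else 0)"

definition Pi_mat :: "'v::finite set set \<Rightarrow> real ^ 'v set ^ ('v set \<times> 'v set)" where
  "Pi_mat \<Delta> = (\<chi> p T. if p \<in> facet_pairs \<Delta> \<and> T \<in> nonempty_faces \<Delta> \<and> fst p \<subseteq> T \<and> T \<subseteq> snd p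
     then (- 1) ^ (card (fst p) + card T) else 0)"

definition sign_switch :: "'v::finite set \<Rightarrow> real ^ 'v set \<Rightarrow> real ^ 'v set" where
  "sign_switch I a = (\<chi> F. (- 1) ^ card (I \<inter> F) * a $ F)"

text \<open>
  \<open>Psi_mat \<Delta>\<close> is the inverse of \<open>Phi_mat \<Delta>\<close> as a matrix indexed by the nonempty faces. Because of
  the zero padding, the identity matrix of that index set takes the place of \<open>mat 1\<close>.
\<close>

lemma alternating_interval_sum:
  fixes G F :: "'v::finite set"
  assumes "G \<subseteq> F"
  shows "(\<Sum>H | H \<subseteq> F \<and> G \<subseteq> H. (- 1) ^ card H) = (if G = F then (- 1) ^ card F else 0 :: real)"
proof (cases "G = F")
  case True
  then have "{H. H \<subseteq> F \<and> G \<subseteq> H} = {F}" by auto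
  then show ?thesis using True by simp
next
  case False
  have "(\<Sum>H | H \<subseteq> F \<and> G \<subseteq> H. (- 1) ^ card H) = (0 :: real)"
    using card_subsupersets_even_odd[of F G] assms False
    by (intro sum_alternating_cancels) (auto simp: conj_assoc)
  then show ?thesis using False by simp
qed

lemma Phi_Psi_inverse:
  fixes \<Delta> :: "'v::finite set set"
  assumes "abstract_simplicial_complex V \<Delta>"
  defines "E \<equiv> (\<chi> F G. if F = G \<and> F \<in> nonempty_faces \<Delta> then 1 else 0) :: real ^ 'v set ^ 'v set"
  shows "Phi_mat \<Delta> ** Psi_mat \<Delta> = E" and "Psi_mat \<Delta> ** Phi_mat \<Delta> = E"
proof -
  have face: "H \<in> nonempty_faces \<Delta>"
    if "F \<in> nonempty_faces \<Delta>" "G \<in> nonempty_faces \<Delta>" "G \<subseteq> H" "H \<subseteq> F" for F G H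
    using assms that by (auto simp: abstract_simplicial_complex_def nonempty_faces_def)
  have pos: "card H > 0" if "H \<in> nonempty_faces \<Delta>" for H
    using that by (simp add: nonempty_faces_def card_gt_0_iff)
  have sgn: "(- 1 :: real) ^ (card H - Suc 0) = - ((- 1) ^ card H)" if "H \<in> nonempty_faces \<Delta>" for H
    using pos[OF that] by (cases "card H") auto
  have two: "(- 2 :: real) ^ k = (- 1) ^ k * 2 ^ k" for k
    by (simp flip: power_mult_distrib)
  have sq: "(- 1 :: real) ^ k * (- 1) ^ k = 1" for k
    by (simp flip: power_add)
  have "(\<Sum>H\<in>UNIV. Phi_mat \<Delta> $ F $ H * Psi_mat \<Delta> $ H $ G) = E $ F $ G \<and>
        (\<Sum>H\<in>UNIV. Psi_mat \<Delta> $ F $ H * Phi_mat \<Delta> $ H $ G) = E $ F $ G" for F G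
  proof (cases "F \<in> nonempty_faces \<Delta> \<and> G \<in> nonempty_faces \<Delta> \<and> G \<subseteq> F")
    case True
    let ?I = "{H. H \<subseteq> F \<and> G \<subseteq> H}"
    have "(\<Sum>H\<in>UNIV. Phi_mat \<Delta> $ F $ H * Psi_mat \<Delta> $ H $ G) =
          (\<Sum>H\<in>?I. Phi_mat \<Delta> $ F $ H * Psi_mat \<Delta> $ H $ G)"
      by (rule sum.mono_neutral_right) (auto simp: Phi_mat_def Psi_mat_def)
    also have "\<dots> = (\<Sum>H\<in>?I. (- 1) ^ card G * (- 1) ^ card H)"
    proof (rule sum.cong[OF refl])
      fix H assume "H \<in> ?I"
      then show "Phi_mat \<Delta> $ F $ H * Psi_mat \<Delta> $ H $ G = (- 1) ^ card G * (- 1) ^ card H"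
        using True face[of F G H] by (simp add: Phi_mat_def Psi_mat_def two sgn)
    qed
    also have "\<dots> = E $ F $ G"
      using True by (simp add: alternating_interval_sum E_def sq flip: sum_distrib_left)
    finally have 1: "(\<Sum>H\<in>UNIV. Phi_mat \<Delta> $ F $ H * Psi_mat \<Delta> $ H $ G) = E $ F $ G" .
    let ?c = "- ((- 2) ^ (card G - 1) / 2 ^ (card F - 1)) :: real"
    have "(\<Sum>H\<in>UNIV. Psi_mat \<Delta> $ F $ H * Phi_mat \<Delta> $ H $ G) =
          (\<Sum>H\<in>?I. Psi_mat \<Delta> $ F $ H * Phi_mat \<Delta> $ H $ G)"
      by (rule sum.mono_neutral_right) (auto simp: Phi_mat_def Psi_mat_def)
    also have "\<dots> = (\<Sum>H\<in>?I. ?c * (- 1) ^ card H)"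
    proof (rule sum.cong[OF refl])
      fix H assume "H \<in> ?I"
      then show "Psi_mat \<Delta> $ F $ H * Phi_mat \<Delta> $ H $ G = ?c * (- 1) ^ card H"
        using True face[of F G H] by (simp add: Phi_mat_def Psi_mat_def sgn)
    qed
    also have "\<dots> = ?c * (if G = F then (- 1) ^ card F else 0)"
      using True by (simp only: alternating_interval_sum flip: sum_distrib_left)
    also have "\<dots> = E $ F $ G"
      using True by (auto simp: E_def two sgn sq)
    finally show ?thesis using 1 by simp
  next
    case False
    then have "(\<Sum>H\<in>UNIV. Phi_mat \<Delta> $ F $ H * Psi_mat \<Delta> $ H $ G) = 0"
      "(\<Sum>H\<in>UNIV. Psi_mat \<Delta> $ F $ H * Phi_mat \<Delta> $ H $ G) = 0"
      by (intro sum.neutral; auto simp: Phi_mat_def Psi_mat_def)+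
    then show ?thesis using False by (auto simp: E_def)
  qed
  then show "Phi_mat \<Delta> ** Psi_mat \<Delta> = E" "Psi_mat \<Delta> ** Phi_mat \<Delta> = E"
    by (simp_all add: vec_eq_iff matrix_matrix_mult_def)
qed

end

theory Submission
  imports Defs
begin

text \<open>
  Passing from \<open>S\<close> to \<open>sym_diff S I\<close> permutes the vertices of the marginal polytope, and this
  permutation is induced by a symmetry of the polytope: the permutation of coordinates
  \<open>(H, F) \<mapsto> (sym_diff H (I \<inter> F), F)\<close> (\<open>switch_coords\<close>, \<open>switch_coords_marg_vertex\<close>).
  A facet-defining inequality stays facet-defining when it is composed with a symmetry of the
  polytope (\<open>facet_defining_convex_hull_symmetry\<close>). So it is enough that the switched functional
  agrees on the polytope, up to an additive constant, with \<open>r\<close> composed with this permutation of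
  coordinates.

  For this only the values at vertices matter. Write \<open>w\<close> for the indicator vector of the nonempty
  faces contained in \<open>S\<close>, \<open>u\<close> for the vertex of \<open>S\<close> and \<open>d\<close> for its parity vector. Then \<open>\<Omega> u = w\<close>
  and \<open>\<Phi> w = d\<close>, so \<open>\<Phi> \<Omega>\<close> maps the vertices of the marginal polytope to the parity vectors,
  which generalize the cut vectors of a graph. In the other direction \<open>\<Pi> w\<close> is \<open>u\<close> minus the vertex of the
  empty set. A functional \<open>r\<close> in the row space of \<open>\<Omega>\<close> vanishes at that vertex, so with
  \<open>a = r \<Pi> \<Psi>\<close> the value of \<open>a\<close> at \<open>d\<close> is the value of \<open>r\<close> at \<open>u\<close>
  (\<open>inner_parity_vec_eq_inner_marg_vertex\<close>).
  On parity vectors, changing the signs of the coefficients of \<open>a\<close> according to \<open>I\<close> amounts to the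
  classical switching operation: it replaces \<open>S\<close> by \<open>sym_diff S I\<close> and subtracts the constant
  \<open>a \<cdot> d\<close> for the set \<open>I\<close> (\<open>sign_switch_inner_parity_vec\<close>).
\<close>

section \<open>Facets under linear symmetries\<close>

lemma facet_of_injective_linear_image:
  fixes f :: "'a::euclidean_space \<Rightarrow> 'b::euclidean_space"
  assumes "linear f" "inj f"
  shows "f ` G facet_of f ` P \<longleftrightarrow> G facet_of P"
  using assms by (simp add: facet_of_def face_of_linear_image)

text \<open>
  Two affine functionals that agree on generators agree on the whole convex hull, so the face cut
  out by one inequality is carried by the symmetry \<open>f\<close> to the face cut out by the other.
\<close>
lemma facet_defining_convex_hull_symmetry:
  fixes f :: "'a::euclidean_space \<Rightarrow> 'a"
  assumes f: "linear f" "inj f" "f ` X = X"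
    and agree: "\<And>x. x \<in> X \<Longrightarrow> s \<bullet> x - s0 = r \<bullet> f x - r0"
    and r: "facet_defining (convex hull X) r r0"
  shows "facet_defining (convex hull X) s s0"
proof -
  let ?P = "convex hull X"
  have image: "f ` ?P = ?P"
    using f by (simp add: convex_hull_linear_image)
  have adj: "r \<bullet> f z = adjoint f r \<bullet> z" for z
    using adjoint_works[OF f(1), of z r] by (simp add: inner_commute)
  have "X \<subseteq> {z. (s - adjoint f r) \<bullet> z = s0 - r0}"
    using agree by (auto simp: adj inner_diff_left algebra_simps)
  then have "?P \<subseteq> {z. (s - adjoint f r) \<bullet> z = s0 - r0}"
    by (intro hull_minimal convex_hyperplane)
  then have eq: "s \<bullet> z - s0 = r \<bullet> f z - r0" if "z \<in> ?P" for z
    using that by (auto simp: adj inner_diff_left algebra_simps)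
  have valid: "s \<bullet> z \<le> s0" if z: "z \<in> ?P" for z
  proof -
    have "r \<bullet> f z \<le> r0"
      using z image r by (auto simp: facet_defining_def)
    then show ?thesis using eq[OF z] by linarith
  qed
  have "f ` {z \<in> ?P. s \<bullet> z = s0} = f ` {z \<in> ?P. r \<bullet> f z = r0}"
    using eq by (intro arg_cong[where f = "image f"]) force
  also have "\<dots> = {z \<in> f ` ?P. r \<bullet> z = r0}" by blast
  finally have face: "f ` {z \<in> ?P. s \<bullet> z = s0} = {z \<in> ?P. r \<bullet> z = r0}"
    unfolding image .
  have "{z \<in> ?P. r \<bullet> z = r0} facet_of ?P"
    using r by (simp add: facet_defining_def)
  then have "f ` {z \<in> ?P. s \<bullet> z = s0} facet_of f ` ?P"
    by (simp only: face image)
  then have "{z \<in> ?P. s \<bullet> z = s0} facet_of ?P"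
    by (rule facet_of_injective_linear_image[OF f(1,2), THEN iffD1])
  then show ?thesis
    using valid by (simp add: facet_defining_def)
qed

section \<open>The switching symmetry of the marginal polytope\<close>

definition switch_coords ::
    "'v::finite set \<Rightarrow> real ^ ('v set \<times> 'v set) \<Rightarrow> real ^ ('v set \<times> 'v set)" where
  "switch_coords I z = (\<chi> p. z $ (sym_diff (fst p) (I \<inter> snd p), snd p))"

lemma linear_switch_coords: "linear (switch_coords I)"
  by (rule linearI) (simp_all add: switch_coords_def vec_eq_iff)

lemma switch_coords_involution: "switch_coords I (switch_coords I z) = z"
proof -
  have "sym_diff (sym_diff H A) A = H" for H A :: "'a set"
    by blast
  then show ?thesis
    by (simp add: switch_coords_def vec_eq_iff)
qed

lemma inj_switch_coords: "inj (switch_coords I)"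
  by (metis injI switch_coords_involution)

lemma switch_coords_marg_vertex:
  "switch_coords I (marg_vertex \<Delta> S) = marg_vertex \<Delta> (sym_diff S I)"
proof -
  have "sym_diff H (I \<inter> F) \<subseteq> F \<longleftrightarrow> H \<subseteq> F" for H F
    by blast
  moreover have "S \<inter> F = sym_diff H (I \<inter> F) \<longleftrightarrow> sym_diff S I \<inter> F = H" if "H \<subseteq> F" for H F
    using that by blast
  ultimately show ?thesis
    by (auto simp: switch_coords_def marg_vertex_def vec_eq_iff facet_pairs_def)
qed

lemma switch_coords_image_marg_vertices:
  assumes "I \<subseteq> V"
  shows "switch_coords I ` {marg_vertex \<Delta> S |S. S \<subseteq> V} = {marg_vertex \<Delta> S |S. S \<subseteq> V}"
    (is "_ ` ?X = ?X")
proof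
  show sub: "switch_coords I ` ?X \<subseteq> ?X"
  proof clarsimp
    fix S assume "S \<subseteq> V"
    with assms show "\<exists>T. switch_coords I (marg_vertex \<Delta> S) = marg_vertex \<Delta> T \<and> T \<subseteq> V"
      unfolding switch_coords_marg_vertex by blast
  qed
  show "?X \<subseteq> switch_coords I ` ?X"
  proof
    fix z assume "z \<in> ?X"
    then have "switch_coords I z \<in> ?X"
      using sub by blast
    then show "z \<in> switch_coords I ` ?X"
      by (intro image_eqI[where x = "switch_coords I z"]) (simp_all only: switch_coords_involution)
  qed
qed

section \<open>Change of coordinates on the vertices\<close>

definition faces_below_vec :: "'v::finite set set \<Rightarrow> 'v set \<Rightarrow> real ^ 'v set" where
  "faces_below_vec \<Delta> S = (\<chi> T. if T \<in> nonempty_faces \<Delta> \<and> T \<subseteq> S then 1 else 0)"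

lemma face_subset_facet:
  fixes \<Delta> :: "'v::finite set set"
  assumes "T \<in> \<Delta>"
  obtains F where "F \<in> facets \<Delta>" "T \<subseteq> F"
proof -
  obtain F where "F \<in> \<Delta>" "T \<subseteq> F" "\<forall>G\<in>\<Delta>. F \<subseteq> G \<longrightarrow> F = G"
    using finite_has_maximal2[of \<Delta> T] assms by auto
  then show thesis
    by (intro that[of F]) (auto simp: facets_def)
qed

text \<open>
  If \<open>T \<subseteq> S\<close>, each facet \<open>F\<close> containing \<open>T\<close> contributes exactly one coordinate, namely
  \<open>(S \<inter> F, F)\<close>; the weight in \<open>Omega_mat\<close> averages over these facets.
\<close>
lemma Omega_mat_marg_vertex: "Omega_mat \<Delta> *v marg_vertex \<Delta> S = faces_below_vec \<Delta> S"
proof -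
  have "(\<Sum>p\<in>UNIV. Omega_mat \<Delta> $ T $ p * marg_vertex \<Delta> S $ p) = faces_below_vec \<Delta> S $ T" for T
  proof (cases "T \<in> nonempty_faces \<Delta> \<and> T \<subseteq> S")
    case False
    then show ?thesis
      by (auto simp: Omega_mat_def marg_vertex_def faces_below_vec_def intro!: sum.neutral)
  next
    case True
    let ?A = "{F \<in> facets \<Delta>. T \<subseteq> F}"
    let ?n = "num_facets_containing \<Delta> T"
    have "T \<in> \<Delta>" using True by (simp add: nonempty_faces_def)
    then have "?A \<noteq> {}" by (metis (mono_tags, lifting) empty_Collect_eq face_subset_facet)
    then have "?n \<noteq> 0"
      by (simp add: num_facets_containing_def)
    have "(\<Sum>p\<in>UNIV. Omega_mat \<Delta> $ T $ p * marg_vertex \<Delta> S $ p) =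
          (\<Sum>p\<in>(\<lambda>F. (S \<inter> F, F)) ` ?A. 1 / real ?n)"
      using True
      by (intro sum.mono_neutral_cong_right)
        (auto simp: Omega_mat_def marg_vertex_def facet_pairs_def image_iff)
    also have "\<dots> = (\<Sum>F\<in>?A. 1 / real ?n)"
      by (rule sum.reindex_cong[OF _ refl refl]) (auto simp: inj_on_def)
    also have "\<dots> = 1"
      using \<open>?n \<noteq> 0\<close> by (simp add: num_facets_containing_def)
    finally show ?thesis using True by (simp add: faces_below_vec_def)
  qed
  then show ?thesis
    by (simp add: matrix_vector_mult_def vec_eq_iff)
qed

lemma sum_Pow_power_card:
  fixes x :: "'a::comm_semiring_1"
  assumes "finite A"
  shows "(\<Sum>H\<in>Pow A. x ^ card H) = (x + 1) ^ card A"
  using prod_add[OF assms, of "\<lambda>_. x" "\<lambda>_. 1"] by simp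

text \<open>
  By the binomial theorem the powers of \<open>- 2\<close> over all nonempty subsets of \<open>F \<inter> S\<close> sum to
  \<open>(- 1) ^ card (F \<inter> S) - 1\<close>, and the entries of \<open>Phi_mat\<close> carry an extra factor \<open>- 1 / 2\<close>.
\<close>
lemma Phi_mat_faces_below_vec:
  fixes \<Delta> :: "'v::finite set set"
  assumes "abstract_simplicial_complex V \<Delta>"
  shows "Phi_mat \<Delta> *v faces_below_vec \<Delta> S = parity_vec \<Delta> S"
proof -
  have "(\<Sum>H\<in>UNIV. Phi_mat \<Delta> $ F $ H * faces_below_vec \<Delta> S $ H) = parity_vec \<Delta> S $ F" for F
  proof (cases "F \<in> nonempty_faces \<Delta>")
    case False
    then show ?thesis by (simp add: Phi_mat_def parity_vec_def)
  next
    case True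
    then have face: "H \<in> nonempty_faces \<Delta>" if "H \<subseteq> F" "H \<noteq> {}" for H
      using assms that by (auto simp: abstract_simplicial_complex_def nonempty_faces_def)
    have half: "(- 2 :: real) ^ (card H - 1) = - ((- 2) ^ card H) / 2" if "H \<noteq> {}" for H :: "'v set"
      using that by (cases "card H") auto
    have "(\<Sum>H\<in>UNIV. Phi_mat \<Delta> $ F $ H * faces_below_vec \<Delta> S $ H) =
          (\<Sum>H\<in>Pow (F \<inter> S) - {{}}. - ((- 2) ^ card H) / 2)"
      using True face half
      by (intro sum.mono_neutral_cong_right)
        (auto simp: Phi_mat_def faces_below_vec_def nonempty_faces_def)
    also have "\<dots> = - ((\<Sum>H\<in>Pow (F \<inter> S) - {{}}. (- 2) ^ card H) / 2)"
      by (simp add: sum_negf sum_divide_distrib)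
    also have "(\<Sum>H\<in>Pow (F \<inter> S) - {{}}. (- 2 :: real) ^ card H) = (- 1) ^ card (F \<inter> S) - 1"
      using sum_Pow_power_card[of "F \<inter> S" "- 2 :: real"] by (simp add: sum_diff1)
    also have "- (((- 1 :: real) ^ card (F \<inter> S) - 1) / 2) = parity_vec \<Delta> S $ F"
      using True by (simp add: parity_vec_def)
    finally show ?thesis .
  qed
  then show ?thesis
    by (simp add: matrix_vector_mult_def vec_eq_iff)
qed

text \<open>
  In row \<open>(H, F)\<close> the product is an alternating sum over the interval from \<open>H\<close> to \<open>S \<inter> F\<close>, which
  detects \<open>H = S \<inter> F\<close>. The term of the empty set is missing from this sum; it belongs to the
  interval only if \<open>H = {}\<close>, and its absence accounts for the subtracted vertex.
\<close>
lemma Pi_mat_faces_below_vec: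
  fixes \<Delta> :: "'v::finite set set"
  assumes "abstract_simplicial_complex V \<Delta>"
  shows "Pi_mat \<Delta> *v faces_below_vec \<Delta> S = marg_vertex \<Delta> S - marg_vertex \<Delta> {}"
proof -
  have "(\<Sum>T\<in>UNIV. Pi_mat \<Delta> $ p $ T * faces_below_vec \<Delta> S $ T) =
        (marg_vertex \<Delta> S - marg_vertex \<Delta> {}) $ p" for p
  proof (cases "p \<in> facet_pairs \<Delta>")
    case False
    then show ?thesis by (simp add: Pi_mat_def marg_vertex_def)
  next
    case True
    obtain H F where p: "p = (H, F)" by (cases p)
    have HF: "H \<subseteq> F" "F \<in> \<Delta>"
      using True by (auto simp: p facet_pairs_def facets_def)
    then have face: "T \<in> nonempty_faces \<Delta>" if "T \<subseteq> F" "T \<noteq> {}" for T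
      using assms that by (auto simp: abstract_simplicial_complex_def nonempty_faces_def)
    let ?J = "{T. T \<subseteq> S \<inter> F \<and> H \<subseteq> T}"
    let ?e = "\<lambda>T. (- 1 :: real) ^ card T"
    have "(\<Sum>T\<in>UNIV. Pi_mat \<Delta> $ p $ T * faces_below_vec \<Delta> S $ T) =
          (\<Sum>T\<in>?J - {{}}. ?e H * ?e T)"
      using True face
      by (intro sum.mono_neutral_cong_right)
        (auto simp: p Pi_mat_def faces_below_vec_def nonempty_faces_def power_add)
    also have "\<dots> = ?e H * (\<Sum>T\<in>?J. ?e T) - (if H = {} then 1 else 0)"
      by (simp add: sum_diff1 sum_distrib_left)
    also have "(\<Sum>T\<in>?J. ?e T) = (if S \<inter> F = H then ?e H else 0)"
    proof (cases "H \<subseteq> S \<inter> F")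
      case True
      then show ?thesis by (subst alternating_interval_sum) auto
    next
      case False
      then have "?J = {}" by blast
      then have "(\<Sum>T\<in>?J. ?e T) = 0" by (simp only: sum.empty)
      moreover have "S \<inter> F \<noteq> H" using False by blast
      ultimately show ?thesis by simp
    qed
    also have "?e H * (if S \<inter> F = H then ?e H else 0) - (if H = {} then 1 else 0) =
        (marg_vertex \<Delta> S - marg_vertex \<Delta> {}) $ p"
      using True by (auto simp: p marg_vertex_def simp flip: power_add)
    finally show ?thesis .
  qed
  then show ?thesis
    by (simp add: matrix_vector_mult_def vec_eq_iff)
qed

text \<open>
  The vertex of the empty set lies in the kernel of \<open>Omega_mat\<close>, since no nonempty face is
  contained in the empty set.
\<close>
lemma row_space_Omega_mat_inner_empty_vertex:
  assumes "r \<in> span (rows (Omega_mat \<Delta>))"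
  shows "r \<bullet> marg_vertex \<Delta> {} = 0"
proof -
  have "faces_below_vec \<Delta> {} = 0"
    by (simp add: faces_below_vec_def nonempty_faces_def vec_eq_iff)
  then have "Omega_mat \<Delta> *v marg_vertex \<Delta> {} = 0"
    by (simp add: Omega_mat_marg_vertex)
  then show ?thesis
    using orthogonal_nullspace_rowspace[OF _ assms] by (metis inner_commute orthogonal_def)
qed

lemma inner_parity_vec_eq_inner_marg_vertex:
  assumes \<Delta>: "abstract_simplicial_complex V \<Delta>" and r: "r \<in> span (rows (Omega_mat \<Delta>))"
  shows "(r v* Pi_mat \<Delta> v* Psi_mat \<Delta>) \<bullet> parity_vec \<Delta> S = r \<bullet> marg_vertex \<Delta> S"
proof -
  have "Psi_mat \<Delta> *v parity_vec \<Delta> S = (Psi_mat \<Delta> ** Phi_mat \<Delta>) *v faces_below_vec \<Delta> S"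
    by (simp add: Phi_mat_faces_below_vec[OF \<Delta>] flip: matrix_vector_mul_assoc)
  also have "\<dots> = faces_below_vec \<Delta> S"
    unfolding Phi_Psi_inverse(2)[OF \<Delta>]
    by (auto simp: vec_eq_iff matrix_vector_mult_def faces_below_vec_def if_distribR
        if_distrib[of "\<lambda>x. x * _"] if_bool_eq_conj sum.If_cases)
  finally show ?thesis
    by (simp add: dot_lmul_matrix Pi_mat_faces_below_vec[OF \<Delta>] inner_diff_right
        row_space_Omega_mat_inner_empty_vertex[OF r])
qed

section \<open>Switching on parity vectors\<close>

lemma even_card_sym_diff:
  assumes "finite A" "finite B"
  shows "even (card (sym_diff A B)) \<longleftrightarrow> (even (card A) \<longleftrightarrow> even (card B))"
proof -
  have "card A = card (A - B) + card (A \<inter> B)" "card B = card (B - A) + card (A \<inter> B)"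
    using assms by (subst card_Un_disjoint[symmetric]; auto intro!: arg_cong[where f = card])+
  moreover have "card (sym_diff A B) = card (A - B) + card (B - A)"
    using assms by (intro card_Un_disjoint) auto
  ultimately show ?thesis by auto
qed

text \<open>
  The parity of \<open>F \<inter> sym_diff S I\<close> is the sum modulo 2 of the parities for \<open>S\<close> and for \<open>I\<close>: it
  equals the parity for \<open>S\<close> if the one for \<open>I\<close> is even and its complement otherwise, and the
  complement \<open>1 - x\<close> is \<open>- x\<close> plus the parity for \<open>I\<close>.
\<close>
lemma sign_switch_inner_parity_vec:
  "sign_switch I a \<bullet> parity_vec \<Delta> S =
   a \<bullet> parity_vec \<Delta> (sym_diff S I) - a \<bullet> parity_vec \<Delta> I"
proof -
  have "(- 1) ^ card (I \<inter> F) * parity_vec \<Delta> S $ F =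
        parity_vec \<Delta> (sym_diff S I) $ F - parity_vec \<Delta> I $ F" for F
  proof -
    have "F \<inter> sym_diff S I = sym_diff (F \<inter> S) (F \<inter> I)" by blast
    then have "even (card (F \<inter> sym_diff S I)) \<longleftrightarrow>
        (even (card (F \<inter> S)) \<longleftrightarrow> even (card (F \<inter> I)))"
      using even_card_sym_diff[of "F \<inter> S" "F \<inter> I"] by simp
    then show ?thesis
      by (auto simp: parity_vec_def Int_commute[of I F])
  qed
  then have "sign_switch I a \<bullet> parity_vec \<Delta> S =
      a \<bullet> (parity_vec \<Delta> (sym_diff S I) - parity_vec \<Delta> I)"
    by (simp add: inner_vec_def sign_switch_def mult.left_commute mult.assoc)
  then show ?thesis by (simp add: inner_diff_right)
qed

section \<open>Switching facet-defining inequalities\<close>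

theorem corollary3p11:
  fixes V I :: "'v::finite set" and \<Delta> :: "'v set set"
    and r :: "real ^ ('v set \<times> 'v set)" and r0 :: real
  assumes "abstract_simplicial_complex V \<Delta>"
    and "facet_defining (Marg V \<Delta>) r r0"
    and "r \<in> span (rows (Omega_mat \<Delta>))"
    and "I \<subseteq> V"
  shows "facet_defining (Marg V \<Delta>)
           (sign_switch I (r v* Pi_mat \<Delta> v* Psi_mat \<Delta>) v* Phi_mat \<Delta> v* Omega_mat \<Delta>)
           (r0 - (r v* Pi_mat \<Delta> v* Psi_mat \<Delta>) \<bullet> parity_vec \<Delta> I)"
proof -
  define a where "a = r v* Pi_mat \<Delta> v* Psi_mat \<Delta>"
  have "(sign_switch I a v* Phi_mat \<Delta> v* Omega_mat \<Delta>) \<bullet> marg_vertex \<Delta> S =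
        r \<bullet> switch_coords I (marg_vertex \<Delta> S) - a \<bullet> parity_vec \<Delta> I" for S
  proof -
    have "(sign_switch I a v* Phi_mat \<Delta> v* Omega_mat \<Delta>) \<bullet> marg_vertex \<Delta> S =
          sign_switch I a \<bullet> parity_vec \<Delta> S"
      by (simp add: dot_lmul_matrix Omega_mat_marg_vertex Phi_mat_faces_below_vec[OF assms(1)])
    also have "\<dots> = a \<bullet> parity_vec \<Delta> (sym_diff S I) - a \<bullet> parity_vec \<Delta> I"
      by (rule sign_switch_inner_parity_vec)
    also have "a \<bullet> parity_vec \<Delta> (sym_diff S I) = r \<bullet> switch_coords I (marg_vertex \<Delta> S)"
      unfolding a_def switch_coords_marg_vertex
      by (rule inner_parity_vec_eq_inner_marg_vertex[OF assms(1,3)])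
    finally show ?thesis .
  qed
  then have agree: "(sign_switch I a v* Phi_mat \<Delta> v* Omega_mat \<Delta>) \<bullet> x - (r0 - a \<bullet> parity_vec \<Delta> I) =
      r \<bullet> switch_coords I x - r0" if "x \<in> {marg_vertex \<Delta> S |S. S \<subseteq> V}" for x
    using that by auto
  show ?thesis
    unfolding Marg_def a_def[symmetric]
    using linear_switch_coords inj_switch_coords switch_coords_image_marg_vertices[OF assms(4)]
      agree assms(2)[unfolded Marg_def]
    by (rule facet_defining_convex_hull_symmetry)
qed

end
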